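(* Let $N\ge2$, let $\lambda_1,\dots,\lambda_N$ be distinct real numbers, and let $a_1,\dots,a_N$ be complex numbers. Let $\mathcal Z$ be the $N\times N$ matrix with diagonal entries $\mathcal Z_{ii}=a_i$ and off-diagonal entries $$\mathcal Z_{ij}=\frac1{\lambda_j-\lambda_i}\qquad(i\ne j).$$ If all eigenvalues of the matrix $\mathcal Z$ are real, then the numbers $a_1,\dots,a_N$ are real. *)

theory Defs
  imports "Jordan_Normal_Form.Char_Poly" Complex_Main
begin

(* The indices 1, ..., N are shifted to 0, ..., N - 1. *)
definition Z_mat :: "nat \<Rightarrow> (nat \<Rightarrow> real) \<Rightarrow> (nat \<Rightarrow> complex) \<Rightarrow> complex mat" where
  "Z_mat N l a = mat N N
    (\<lambda>(i, j). if i = j then a i else 1 / complex_of_real (l j - l i))"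

end

theory Submission
  imports Defs "HOL-Combinatorics.Permutations"
begin

text \<open>
  On functions of the permutations \<open>\<sigma>\<close> of the indices, consider the Gaudin-type operators
  \<open>(A\<^sub>i F)(\<sigma>) = a (\<sigma> i) F(\<sigma>) - (\<Sum>j \<noteq> i. F(\<sigma> \<circ> (i j)) / (l (\<sigma> i) - l (\<sigma> j)))\<close>. They commute, and the
  product of all \<open>A\<^sub>i - x\<close> maps the constant function 1 to the constant \<open>det (Z - x)\<close>. Starting from
  the constant function one therefore reaches a joint eigenvector \<open>u\<close> of the \<open>A\<^sub>i\<close> whose eigenvalues
  \<open>w i\<close> are eigenvalues of \<open>Z\<close>, hence real. Reading the equation \<open>A\<^sub>i u = w i u\<close> at \<open>\<sigma>\<close> with
  \<open>\<sigma> i = m\<close> the other way round,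
  \<open>a m u(\<sigma>) = w (\<sigma>\<^sup>-\<^sup>1 m) u(\<sigma>) + (\<Sum>n \<noteq> m. u((m n) \<circ> \<sigma>) / (l m - l n))\<close>,
  so \<open>a m\<close> is an eigenvalue of a real symmetric operator once the \<open>w i\<close> are real.
\<close>

section \<open>Determinants of Calogero--Moser matrices\<close>

text \<open>Row \<open>n\<close> is a unit vector, whatever \<open>c n\<close> is, and the minor
  left by the expansion along it is the identity. This covers the row and column operations
  \<open>E\<close> and \<open>F\<close> used further down.\<close>

lemma det_one_plus_column:
  fixes c :: "nat \<Rightarrow> 'a :: comm_ring_1"
  assumes "n < N"
  shows "det (mat N N (\<lambda>(i, j). if i = j then 1 else if j = n then c i else 0)) = 1"
    (is "det ?A = 1")
proof -
  have del: "mat_delete ?A n n = 1\<^sub>m (N - 1)"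
    using assms by (intro eq_matI) (auto simp: mat_delete_def)
  have "det ?A = (\<Sum>j<N. ?A $$ (n, j) * cofactor ?A n j)"
    using assms by (intro laplace_expansion_row) auto
  also have "\<dots> = (\<Sum>j<N. if j = n then cofactor ?A n n else 0)"
    using assms by (intro sum.cong) auto
  also have "\<dots> = cofactor ?A n n"
    using assms by simp
  also have "\<dots> = 1"
    by (simp add: cofactor_def del)
  finally show ?thesis .
qed

text \<open>Cramer's rule without division: \<open>det (replace_col A b k)\<close> is entry
  \<open>k\<close> of the adjugate applied to \<open>b\<close>, and \<open>A * adj_mat A\<close> is
  \<open>det A\<close> times the identity.\<close>

lemma sum_row_times_det_replace_col:
  fixes A :: "'a :: comm_ring_1 mat"
  assumes A: "A \<in> carrier_mat n n" and b: "b \<in> carrier_vec n" and m: "m < n"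
  shows "(\<Sum>k<n. A $$ (m, k) * det (replace_col A b k)) = det A * b $ m"
proof -
  have rep: "det (replace_col A b k) = (\<Sum>i<n. b $ i * cofactor A i k)" if "k < n" for k
  proof -
    have c: "replace_col A b k \<in> carrier_mat n n"
      using A by (auto simp: replace_col_def)
    have "mat_delete (replace_col A b k) i k = mat_delete A i k" if "i < n" for i
      using A that \<open>k < n\<close> by (intro eq_matI) (auto simp: mat_delete_def replace_col_def)
    then show ?thesis
      using laplace_expansion_column[OF c that] A that
      by (auto simp: cofactor_def replace_col_def intro!: sum.cong)
  qed
  have "(\<Sum>k<n. A $$ (m, k) * det (replace_col A b k))
      = (\<Sum>k<n. \<Sum>i<n. A $$ (m, k) * cofactor A i k * b $ i)"
    by (intro sum.cong refl) (simp add: rep sum_distrib_left ac_simps)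
  also have "\<dots> = (\<Sum>i<n. (\<Sum>k<n. A $$ (m, k) * cofactor A i k) * b $ i)"
    unfolding sum_distrib_right by (rule sum.swap)
  also have "\<dots> = (\<Sum>i<n. (A * adj_mat A) $$ (m, i) * b $ i)"
    using A m by (intro sum.cong) (auto simp: adj_mat_def scalar_prod_def atLeast0LessThan)
  also have "\<dots> = (\<Sum>i<n. if i = m then det A * b $ m else 0)"
    using m adj_mat(2)[OF A] by (intro sum.cong) auto
  finally show ?thesis
    using m by simp
qed

text \<open>
  \<open>cm_mat N l a S\<close> is the principal submatrix of \<open>Z\<close> on \<open>S\<close> with a corrected diagonal, padded by the
  identity outside \<open>S\<close> so that its size does not depend on \<open>S\<close>. The correction is what makes these
  determinants the partial products of the commuting operators applied to 1.
\<close>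

definition cm_diag :: "nat \<Rightarrow> (nat \<Rightarrow> complex) \<Rightarrow> (nat \<Rightarrow> complex) \<Rightarrow> nat set \<Rightarrow> nat \<Rightarrow> complex" where
  "cm_diag N l a S i = a i - (\<Sum>k\<in>{..<N} - S. 1 / (l i - l k))"

definition cm_mat :: "nat \<Rightarrow> (nat \<Rightarrow> complex) \<Rightarrow> (nat \<Rightarrow> complex) \<Rightarrow> nat set \<Rightarrow> complex mat" where
  "cm_mat N l a S = mat N N (\<lambda>(i, j).
     if i \<in> S \<and> j \<in> S then if i = j then cm_diag N l a S i else 1 / (l j - l i)
     else if i = j then 1 else 0)"

lemma cm_mat_carrier [simp]: "cm_mat N l a S \<in> carrier_mat N N"
  by (simp add: cm_mat_def)

lemma dim_cm_mat [simp]: "dim_row (cm_mat N l a S) = N" "dim_col (cm_mat N l a S) = N"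
  by (simp_all add: cm_mat_def)

lemma cm_diag_remove:
  assumes "U \<subseteq> {..<N}" "n \<in> U"
  shows "cm_diag N l a (U - {n}) i = cm_diag N l a U i - 1 / (l i - l n)"
proof -
  have "{..<N} - (U - {n}) = insert n ({..<N} - U)"
    using assms by auto
  then show ?thesis
    using assms by (simp add: cm_diag_def)
qed

text \<open>
  Subtract row \<open>n\<close> from the other rows in \<open>U\<close> (the matrix \<open>E\<close>), conjugate by the diagonal matrix
  \<open>X\<close> of the differences \<open>l i - l n\<close>, and clear row \<open>n\<close> by column operations (the matrix \<open>F\<close>).
\<close>

lemma det_replace_col_cm_mat:
  assumes inj: "inj_on l {..<N}" and U: "U \<subseteq> {..<N}" and n: "n \<in> U"
  shows "det (replace_col (cm_mat N l a U) (vec N (\<lambda>i. if i \<in> U then 1 else 0)) n)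
       = det (cm_mat N l a (U - {n}))"
    (is "det ?K = det ?G")
proof -
  have nN: "n < N" using U n by auto
  have ne: "l i \<noteq> l j" if "i < N" "j < N" "i \<noteq> j" for i j
    using inj that by (auto dest: inj_onD)
  define x where "x i = (if i \<in> U - {n} then l i - l n else 1)" for i
  define X where "X = mat N N (\<lambda>(i, j). if i = j then x i else 0)"
  define E where "E = mat N N (\<lambda>(i, j). if i = j then 1 else if j = n then
     (if i \<in> U then - 1 else 0 :: complex) else 0)"
  define F where "F = transpose_mat (mat N N (\<lambda>(i, j). if i = j then 1 else if j = n then
     (if i \<in> U then 1 else 0 :: complex) else 0))"
  have K: "?K \<in> carrier_mat N N" by (simp add: replace_col_def cm_mat_def)
  have X: "X \<in> carrier_mat N N" and E: "E \<in> carrier_mat N N" and F: "F \<in> carrier_mat N N"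
    by (simp_all add: X_def E_def F_def)
  have G: "?G \<in> carrier_mat N N" by simp
  have detE: "det E = 1" unfolding E_def by (rule det_one_plus_column[OF nN])
  have detF: "det F = 1" unfolding F_def
    by (subst det_transpose[of _ N]) (simp, rule det_one_plus_column[OF nN])
  have "det X = prod_list (diag_mat X)"
    by (rule det_upper_triangular[OF _ X]) (auto simp: X_def)
  also have "\<dots> = (\<Prod>i = 0..<N. X $$ (i, i))"
    using X by (simp add: prod_list_diag_prod)
  also have "\<dots> \<noteq> 0"
    using U n nN by (auto simp: X_def x_def dest!: ne[OF _ nN] subsetD)
  finally have detX: "det X \<noteq> 0" .
  \<comment> \<open>This is \<open>E K = X (G F) X^(-1)\<close> multiplied out, so that no inverse
    appears; the nonzero \<open>det X\<close> cancels after taking determinants.\<close>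
  have eq: "(E * ?K) * X = X * (?G * F)"
  proof (rule eq_matI)
    fix i j
    assume "i < dim_row (X * (?G * F))" "j < dim_col (X * (?G * F))"
    then have i: "i < N" and j: "j < N" using X F by auto
    have "(E * ?K) $$ (i, k) = ?K $$ (i, k) - (if i \<in> U - {n} then ?K $$ (n, k) else 0)"
      if k: "k < N" for k
    proof -
      have "(E * ?K) $$ (i, k) = (\<Sum>p = 0..<N. E $$ (i, p) * ?K $$ (p, k))"
        using E K i k by (simp add: scalar_prod_def)
      also have "\<dots> = (\<Sum>p = 0..<N. (if p = i then ?K $$ (i, k) else 0)
          - (if p = n then if i \<in> U - {n} then ?K $$ (n, k) else 0 else 0))"
        using i by (intro sum.cong) (auto simp: E_def)
      finally show ?thesis
        using i nN by (simp add: sum_subtractf)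
    qed
    note EK = this
    have "((E * ?K) * X) $$ (i, j) = (\<Sum>p = 0..<N. (E * ?K) $$ (i, p) * X $$ (p, j))"
    proof -
      have "(P * X) $$ (i, j) = (\<Sum>p = 0..<N. P $$ (i, p) * X $$ (p, j))" if "P \<in> carrier_mat N N" for P
        using that X i j by (simp add: scalar_prod_def)
      then show ?thesis using E K by (meson mult_carrier_mat)
    qed
    also have "\<dots> = (\<Sum>p = 0..<N. if p = j then (E * ?K) $$ (i, j) * x j else 0)"
      using j by (intro sum.cong) (auto simp: X_def)
    also have "\<dots> = (?K $$ (i, j) - (if i \<in> U - {n} then ?K $$ (n, j) else 0)) * x j"
      using j by (simp add: EK del: replace_col_def)
    finally have lhs: "((E * ?K) * X) $$ (i, j) = \<dots>" .
    have GF: "(?G * F) $$ (i, j) = ?G $$ (i, j) + (if j \<in> U - {n} then ?G $$ (i, n) else 0)"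
    proof -
      have "(?G * F) $$ (i, j) = (\<Sum>p = 0..<N. ?G $$ (i, p) * F $$ (p, j))"
        using G F i j by (simp add: scalar_prod_def)
      also have "\<dots> = (\<Sum>p = 0..<N. (if p = j then ?G $$ (i, j) else 0)
          + (if p = n then if j \<in> U - {n} then ?G $$ (i, n) else 0 else 0))"
        using j by (intro sum.cong) (auto simp: F_def)
      finally show ?thesis
        using j nN by (simp add: sum.distrib)
    qed
    have GFc: "?G * F \<in> carrier_mat N N" by (rule mult_carrier_mat[OF G F])
    have "(X * (?G * F)) $$ (i, j) = (\<Sum>p = 0..<N. X $$ (i, p) * (?G * F) $$ (p, j))"
    proof -
      have "(X * P) $$ (i, j) = (\<Sum>p = 0..<N. X $$ (i, p) * P $$ (p, j))" if "P \<in> carrier_mat N N" for P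
        using that X i j by (simp add: scalar_prod_def)
      then show ?thesis using GFc by blast
    qed
    also have "\<dots> = (\<Sum>p = 0..<N. if p = i then x i * (?G * F) $$ (i, j) else 0)"
      using i by (intro sum.cong) (auto simp: X_def)
    also have "\<dots> = x i * (?G $$ (i, j) + (if j \<in> U - {n} then ?G $$ (i, n) else 0))"
      using i by (simp add: GF)
    finally have rhs: "(X * (?G * F)) $$ (i, j) = \<dots>" .
    have lj: "l j - l n \<noteq> 0" if "j \<noteq> n" using ne[OF j nN that] by simp
    let ?k = "\<lambda>p. if j = n then if p \<in> U then 1 else 0 else cm_mat N l a U $$ (p, j)"
    have K_entry: "?K $$ (p, j) = ?k p" if "p < N" for p
      using that j by (simp add: replace_col_def)
    consider "j = n" | "j \<noteq> n" "j \<notin> U" | "j \<noteq> n" "j \<in> U" "i = n"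
      | "j \<noteq> n" "j \<in> U" "i \<noteq> n" "i \<notin> U" | "j \<noteq> n" "j \<in> U" "i = j"
      | "j \<noteq> n" "j \<in> U" "i \<noteq> n" "i \<in> U" "i \<noteq> j" by blast
    then have "(?k i - (if i \<in> U - {n} then ?k n else 0)) * x j
        = x i * (?G $$ (i, j) + (if j \<in> U - {n} then ?G $$ (i, n) else 0))" (is ?key)
    proof cases
      case 1
      then show ?key using i nN n by (auto simp: cm_mat_def x_def)
    next
      case 2
      then show ?key using i j nN n by (auto simp: cm_mat_def x_def)
    next
      case 3
      then show ?key using j nN n lj by (simp add: cm_mat_def x_def)
    next
      case 4
      then show ?key using i j nN n by (auto simp: cm_mat_def x_def)
    next
      case 5
      \<comment> \<open>On the diagonal, subtracting row \<open>n\<close> changes the entry by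
        exactly the amount by which \<open>cm_diag\<close> changes when \<open>n\<close> leaves
        \<open>U\<close>.\<close>
      then show ?key using j nN n by (simp add: cm_mat_def x_def cm_diag_remove[OF U n])
    next
      case 6
      then have "l j - l i \<noteq> 0" using ne[OF j i] by simp
      \<comment> \<open>This partial fraction is the reason for the choice of \<open>X\<close>:
        subtracting row \<open>n\<close> multiplies the entry by
        \<open>(l i - l n) / (l j - l n)\<close>.\<close>
      then have "(1 / (l j - l i) - 1 / (l j - l n)) * (l j - l n) = (l i - l n) * (1 / (l j - l i))"
        using lj[OF 6(1)] diff_frac_eq[of "l j - l i" "l j - l n" 1 1] by simp
      then show ?key using 6 i j nN n by (simp add: cm_mat_def x_def)
    qed
    then show "((E * ?K) * X) $$ (i, j) = (X * (?G * F)) $$ (i, j)"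
      unfolding lhs rhs K_entry[OF i] K_entry[OF nN] .
  next
    show "dim_row ((E * ?K) * X) = dim_row (X * (?G * F))"
      using E X by (simp only: index_mult_mat carrier_matD)
    show "dim_col ((E * ?K) * X) = dim_col (X * (?G * F))"
      using F X by (simp only: index_mult_mat carrier_matD)
  qed
  have "det ((E * ?K) * X) = det E * det ?K * det X"
    using E K X by (simp add: det_mult[of _ N])
  moreover have "det (X * (?G * F)) = det X * (det ?G * det F)"
    using det_mult[OF X mult_carrier_mat[OF G F]] det_mult[OF G F] by simp
  ultimately show ?thesis
    using eq detX by (simp add: detE detF)
qed

text \<open>Cramer's rule for the indicator vector of \<open>U\<close>, read in row
  \<open>m\<close>: each determinant with a replaced column is that of the set with one index
  removed. The resulting recursion has the shape of one application of \<open>cm_op\<close>.\<close>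

lemma det_cm_mat_expand:
  assumes inj: "inj_on l {..<N}" and U: "U \<subseteq> {..<N}" and m: "m \<in> U"
  shows "det (cm_mat N l a U) = cm_diag N l a U m * det (cm_mat N l a (U - {m}))
    - (\<Sum>n\<in>U - {m}. det (cm_mat N l a (U - {n})) / (l m - l n))"
proof -
  let ?M = "cm_mat N l a U" and ?b = "vec N (\<lambda>i. if i \<in> U then 1 else 0 :: complex)"
  have mN: "m < N" using U m by auto
  have fin: "finite U" using U finite_subset by blast
  have "det ?M = det ?M * ?b $ m"
    using m mN by simp
  also have "\<dots> = (\<Sum>k<N. ?M $$ (m, k) * det (replace_col ?M ?b k))"
    using mN by (intro sum_row_times_det_replace_col[symmetric]) auto
  also have "\<dots> = (\<Sum>k\<in>U. ?M $$ (m, k) * det (replace_col ?M ?b k))"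
    using U m mN by (intro sum.mono_neutral_right) (auto simp: cm_mat_def)
  also have "\<dots> = (\<Sum>k\<in>U. ?M $$ (m, k) * det (cm_mat N l a (U - {k})))"
    by (intro sum.cong refl) (simp add: det_replace_col_cm_mat[OF inj U])
  also have "\<dots> = ?M $$ (m, m) * det (cm_mat N l a (U - {m}))
      + (\<Sum>k\<in>U - {m}. ?M $$ (m, k) * det (cm_mat N l a (U - {k})))"
    using fin m by (simp add: sum.remove)
  also have "(\<Sum>k\<in>U - {m}. ?M $$ (m, k) * det (cm_mat N l a (U - {k})))
      = (\<Sum>k\<in>U - {m}. - (det (cm_mat N l a (U - {k})) / (l m - l k)))"
  proof (intro sum.cong refl)
    fix k assume k: "k \<in> U - {m}"
    then have "?M $$ (m, k) = 1 / (l k - l m)"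
      using U m mN by (auto simp: cm_mat_def)
    also have "\<dots> = - (1 / (l m - l k))"
      by (metis minus_diff_eq minus_divide_right)
    finally show "?M $$ (m, k) * det (cm_mat N l a (U - {k})) = - (det (cm_mat N l a (U - {k})) / (l m - l k))"
      by simp
  qed
  finally show ?thesis
    using m mN by (simp add: cm_mat_def sum_negf)
qed

section \<open>Joint eigenvectors\<close>

text \<open>The parameter precedes the index so that \<open>foldr (shift_op A x) js\<close> is the
  product of the operators \<open>A j - x\<close>.\<close>

definition shift_op :: "('i \<Rightarrow> ('x \<Rightarrow> complex) \<Rightarrow> 'x \<Rightarrow> complex) \<Rightarrow> complex
    \<Rightarrow> 'i \<Rightarrow> ('x \<Rightarrow> complex) \<Rightarrow> 'x \<Rightarrow> complex"
  where "shift_op A x j u = (\<lambda>p. A j u p - x * u p)"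

text \<open>
  At a root \<open>z\<close> of the scalar polynomial the product of the \<open>A j - z\<close> annihilates \<open>v\<close>, so some partial
  product applied to \<open>v\<close> is a nonzero eigenvector of one \<open>A j\<close>. Cancelling the factor \<open>z - x\<close> leaves
  the same situation with one operator and one root fewer; continuity covers \<open>x = z\<close>.
\<close>

lemma joint_eigenvector:
  fixes A :: "'i \<Rightarrow> ('x \<Rightarrow> complex) \<Rightarrow> 'x \<Rightarrow> complex"
  assumes lin: "\<And>j c d u v. j \<in> J \<Longrightarrow> A j (\<lambda>p. c * u p + d * v p) = (\<lambda>p. c * A j u p + d * A j v p)"
    and cont: "\<And>j f p. j \<in> J \<Longrightarrow> (\<And>p. continuous_on UNIV (\<lambda>x::complex. f x p))
      \<Longrightarrow> continuous_on UNIV (\<lambda>x. A j (f x) p)"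
    and comm: "\<And>i j u. i \<in> J \<Longrightarrow> j \<in> J \<Longrightarrow> A i (A j u) = A j (A i u)"
    and "set js \<subseteq> J" and "length js = length zs"
    and "P v" and "\<And>j x u. j \<in> J \<Longrightarrow> P u \<Longrightarrow> P (shift_op A x j u)"
    and "v \<noteq> (\<lambda>_. 0)"
    and "\<And>x. foldr (shift_op A x) js v = (\<lambda>p. (\<Prod>z\<leftarrow>zs. z - x) * v p)"
  shows "\<exists>u. P u \<and> u \<noteq> (\<lambda>_. 0) \<and> (\<forall>j\<in>set js. \<exists>w\<in>set zs. A j u = (\<lambda>p. w * u p))"
proof -
  let ?S = "shift_op A"
  have shift_comm: "?S x i (?S y j u) = ?S y j (?S x i u)" if "i \<in> J" "j \<in> J" for x y i j u
    using lin[OF that(1), of 1 "A j u" "- y" u] lin[OF that(2), of 1 "A i u" "- x" u]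
      comm[OF that, of u]
    by (simp add: shift_op_def fun_eq_iff algebra_simps)
  have shift_scale: "?S x j (\<lambda>p. c * u p) = (\<lambda>p. c * ?S x j u p)" if "j \<in> J" for x j c u
    using lin[OF that, of c u 0 u] by (simp add: shift_op_def fun_eq_iff algebra_simps)
  have foldr_comm: "foldr (?S x) js (?S y j u) = ?S y j (foldr (?S x) js u)"
    if "set js \<subseteq> J" "j \<in> J" for js x y j u
    using that by (induction js) (auto simp: shift_comm)
  have foldr_foldr: "foldr (?S x) js (foldr (?S y) ks u) = foldr (?S y) ks (foldr (?S x) js u)"
    if "set js \<subseteq> J" "set ks \<subseteq> J" for js ks x y u
    using that by (induction ks) (auto simp: foldr_comm)
  have foldr_scale: "foldr (?S x) js (\<lambda>p. c * u p) = (\<lambda>p. c * foldr (?S x) js u p)"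
    if "set js \<subseteq> J" for js x c u
    using that by (induction js) (auto simp: shift_scale)
  have foldr_cont: "continuous_on UNIV (\<lambda>x. foldr (?S x) js u p)" if "set js \<subseteq> J" for js u p
    using that
    by (induction js arbitrary: p) (auto simp: shift_op_def intro!: continuous_intros cont)
  \<comment> \<open>Factors act from the right end of the list; \<open>j\<close> is the one at which
    the result first becomes zero.\<close>
  have split: "\<exists>ks j ks'. js = ks @ j # ks' \<and> foldr (?S z) ks' u \<noteq> (\<lambda>_. 0)
      \<and> ?S z j (foldr (?S z) ks' u) = (\<lambda>_. 0)"
    if "foldr (?S z) js u = (\<lambda>_. 0)" "u \<noteq> (\<lambda>_. 0)" for js z u
    using that
  proof (induction js)
    case (Cons j js)
    show ?case
    proof (cases "foldr (?S z) js u = (\<lambda>_. 0)")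
      case True
      then obtain ks i ks' where "js = ks @ i # ks' \<and> foldr (?S z) ks' u \<noteq> (\<lambda>_. 0)
          \<and> ?S z i (foldr (?S z) ks' u) = (\<lambda>_. 0)"
        using Cons by blast
      then show ?thesis by (intro exI[of _ "j # ks"]) auto
    next
      case False
      then show ?thesis using Cons.prems by (intro exI[of _ "[]"]) auto
    qed
  qed simp
  show ?thesis
    using assms(4-)
  proof (induction zs arbitrary: js v P)
    case Nil
    then show ?case by auto
  next
    case (Cons z zs)
    have "foldr (?S z) js v = (\<lambda>_. 0)"
      using Cons.prems(6)[of z] by simp
    from split[OF this Cons.prems(5)] obtain ks j ks' where js: "js = ks @ j # ks'"
      and u0: "foldr (?S z) ks' v \<noteq> (\<lambda>_. 0)"
      and ju0: "?S z j (foldr (?S z) ks' v) = (\<lambda>_. 0)" by blast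
    define u where "u = foldr (?S z) ks' v"
    have J: "set ks \<subseteq> J" "set ks' \<subseteq> J" "j \<in> J" using Cons.prems(1) js by auto
    have ju: "A j u = (\<lambda>p. z * u p)"
      using ju0 by (simp add: u_def shift_op_def fun_eq_iff)
    have Pfold: "P (foldr (?S z) is v)" if "set is \<subseteq> J" for "is"
      using that by (induction "is") (auto intro: Cons.prems)
    have Pu: "P u" unfolding u_def by (rule Pfold[OF J(2)])
    let ?r = "\<lambda>x. foldr (?S x) (ks @ ks') u" and ?q = "\<lambda>x. (\<Prod>z\<leftarrow>zs. z - x)"
    \<comment> \<open>Both sides equal \<open>foldr (?S x) js u p\<close>: one by commuting the
      factors \<open>ks'\<close> at \<open>z\<close> past the hypothesis on \<open>v\<close>, the
      other by \<open>A j u = z u\<close>.\<close>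
    have mult: "(z - x) * ?r x p = (z - x) * (?q x * u p)" for x p
    proof -
      have "foldr (?S x) js u = foldr (?S z) ks' (foldr (?S x) js v)"
        unfolding u_def using foldr_foldr Cons.prems(1) J(2) by blast
      also have "\<dots> = (\<lambda>p. (z - x) * ?q x * u p)"
        unfolding Cons.prems(6) using foldr_scale[OF J(2)] by (simp add: u_def)
      finally have 1: "foldr (?S x) js u p = (z - x) * ?q x * u p" by simp
      have "foldr (?S x) js u = foldr (?S x) ks (foldr (?S x) ks' (?S x j u))"
        using foldr_comm[OF J(2,3)] by (simp add: js)
      also have "?S x j u = (\<lambda>p. (z - x) * u p)"
        by (simp add: shift_op_def ju algebra_simps)
      finally have "foldr (?S x) js u = (\<lambda>p. (z - x) * ?r x p)"
        by (simp add: foldr_scale J)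
      with 1 show ?thesis by (simp add: fun_eq_iff)
    qed
    have req: "?r x p = ?q x * u p" for x p
    proof (cases "x = z")
      case False
      then show ?thesis using mult[of x p] by simp
    next
      case True
      have cq: "continuous_on UNIV ?q"
        by (induction zs) (auto intro!: continuous_intros)
      have "continuous_on UNIV (\<lambda>x. ?r x p - ?q x * u p)"
        using foldr_cont[of "ks @ ks'" u p] cq J by (intro continuous_intros) auto
      then have "isCont (\<lambda>x. ?r x p - ?q x * u p) z"
        by (simp add: continuous_on_eq_continuous_at)
      then have "(\<lambda>x. ?r x p - ?q x * u p) \<midarrow>z\<rightarrow> ?r z p - ?q z * u p"
        by (simp add: isCont_def)
      moreover have "(\<lambda>x. ?r x p - ?q x * u p) \<midarrow>z\<rightarrow> 0"
      proof (rule tendsto_eventually)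
        have "?r x p - ?q x * u p = 0" if "x \<noteq> z" for x
          using mult[of x p] that by simp
        then show "\<forall>\<^sub>F x in at z. ?r x p - ?q x * u p = 0"
          by (simp add: eventually_at_filter)
      qed
      ultimately have "?r z p - ?q z * u p = 0"
        by (rule tendsto_unique[rotated]) simp
      then show ?thesis using True by simp
    qed
    \<comment> \<open>The eigenvalue equation just found joins the invariant, so the vector produced
      by the induction hypothesis is still an eigenvector of \<open>A j\<close>.\<close>
    let ?P = "\<lambda>u. P u \<and> A j u = (\<lambda>p. z * u p)"
    have "\<exists>u. ?P u \<and> u \<noteq> (\<lambda>_. 0) \<and> (\<forall>j\<in>set (ks @ ks'). \<exists>w\<in>set zs. A j u = (\<lambda>p. w * u p))"
    proof (rule Cons.IH)
      show "?P u" using Pu ju by simp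
      show "u \<noteq> (\<lambda>_. 0)" using u0 u_def by simp
      show "?r x = (\<lambda>p. ?q x * u p)" for x using req by auto
      show "?P (?S x i w)" if "i \<in> J" "?P w" for i x w
      proof -
        \<comment> \<open>The shift by 0 is \<open>A j\<close> itself, so commutation of shifts
          gives commutation with \<open>A j\<close>.\<close>
        have "?S 0 j (?S x i w) = ?S x i (?S 0 j w)"
          using shift_comm that(1) J(3) by blast
        also have "?S 0 j w = (\<lambda>p. z * w p)" using that by (simp add: shift_op_def)
        also have "?S x i \<dots> = (\<lambda>p. z * ?S x i w p)" using shift_scale[OF that(1)] .
        finally show ?thesis using Cons.prems(4) that by (simp add: shift_op_def)
      qed
    qed (use Cons.prems J js in auto)
    then show ?case using js by auto
  qed
qed

section \<open>The commuting operators\<close>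

text \<open>Permutations are encoded as total functions on the naturals. The value 0 at all other
  arguments turns commutation into an equality of functions without side condition.\<close>

definition cm_op :: "nat \<Rightarrow> (nat \<Rightarrow> complex) \<Rightarrow> (nat \<Rightarrow> complex) \<Rightarrow> nat
    \<Rightarrow> ((nat \<Rightarrow> nat) \<Rightarrow> complex) \<Rightarrow> (nat \<Rightarrow> nat) \<Rightarrow> complex" where
  "cm_op N l a i F = (\<lambda>\<sigma>. if \<sigma> permutes {..<N} then
     a (\<sigma> i) * F \<sigma> - (\<Sum>j\<in>{..<N} - {i}. F (\<sigma> \<circ> transpose i j) / (l (\<sigma> i) - l (\<sigma> j))) else 0)"

text \<open>Moves a transposition of positions, on the right, to a transposition of labels, on the
  left. It yields the relations between products of transpositions and the rereading of the
  eigenvalue equation.\<close>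

lemma inj_comp_transpose:
  assumes "inj \<sigma>"
  shows "\<sigma> \<circ> transpose i j = transpose (\<sigma> i) (\<sigma> j) \<circ> \<sigma>"
proof
  fix x
  show "(\<sigma> \<circ> transpose i j) x = (transpose (\<sigma> i) (\<sigma> j) \<circ> \<sigma>) x"
    using assms by (cases "x = i \<or> x = j") (auto simp: transpose_apply_other inj_eq)
qed

lemma permutes_comp_transpose:
  assumes "\<sigma> permutes S" "i \<in> S" "j \<in> S"
  shows "\<sigma> \<circ> transpose i j permutes S"
  using assms by (simp add: permutes_compose permutes_swap_id)

text \<open>
  The right-hand side is arranged to be symmetric in \<open>i\<close> and \<open>j\<close>. A 3-cycle on \<open>i, j, k\<close>
  arises twice in one order of composition and once in the other; the two terms combine by
  \<open>1/((x\<^sub>i - x\<^sub>k)(x\<^sub>i - x\<^sub>j)) + 1/((x\<^sub>j - x\<^sub>k)(x\<^sub>i - x\<^sub>k)) = 1/((x\<^sub>i - x\<^sub>j)(x\<^sub>j - x\<^sub>k))\<close>.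
\<close>

lemma cm_op_cm_op:
  assumes inj: "inj_on l {..<N}" and \<sigma>: "\<sigma> permutes {..<N}"
    and ij: "i < N" "j < N" "i \<noteq> j"
  defines "C \<equiv> {..<N} - {i, j}"
    and "x \<equiv> l \<circ> \<sigma>"
  shows "cm_op N l a i (cm_op N l a j F) \<sigma> =
      a (\<sigma> i) * a (\<sigma> j) * F \<sigma>
      - (\<Sum>k\<in>C. a (\<sigma> i) * F (\<sigma> \<circ> transpose j k) / (x j - x k))
      - (\<Sum>k\<in>C. a (\<sigma> j) * F (\<sigma> \<circ> transpose i k) / (x i - x k))
      + F \<sigma> / (x i - x j)^2
      + (\<Sum>k\<in>C. F (\<sigma> \<circ> (transpose i j \<circ> transpose j k)) / ((x i - x j) * (x j - x k))
           + F (\<sigma> \<circ> (transpose j i \<circ> transpose i k)) / ((x j - x i) * (x i - x k)))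
      + (\<Sum>k\<in>C. \<Sum>m\<in>C - {k}. F (\<sigma> \<circ> (transpose i k \<circ> transpose j m)) / ((x i - x k) * (x j - x m)))"
proof -
  have finC: "finite C" by (simp add: C_def)
  have Ci: "{..<N} - {i} = insert j C" and Cj: "{..<N} - {j} = insert i C"
    and jC: "j \<notin> C" and iC: "i \<notin> C"
    using ij by (auto simp: C_def)
  have ne: "x p \<noteq> x q" if "p < N" "q < N" "p \<noteq> q" for p q
  proof -
    have "\<sigma> p \<noteq> \<sigma> q" using permutes_inj[OF \<sigma>] that by (auto dest: injD)
    moreover have "\<sigma> p < N" "\<sigma> q < N" using permutes_in_image[OF \<sigma>] that by auto
    ultimately show ?thesis using inj by (auto simp: x_def dest: inj_onD)
  qed
  have op_j: "cm_op N l a j F \<tau> = a (\<tau> j) * F \<tau> - F (\<tau> \<circ> transpose i j) / (l (\<tau> j) - l (\<tau> i))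
      - (\<Sum>m\<in>C. F (\<tau> \<circ> transpose j m) / (l (\<tau> j) - l (\<tau> m)))" if "\<tau> permutes {..<N}" for \<tau>
    using that finC iC unfolding cm_op_def Cj by (simp add: transpose_commute algebra_simps)
  have at_ij: "cm_op N l a j F (\<sigma> \<circ> transpose i j) = a (\<sigma> i) * F (\<sigma> \<circ> transpose i j)
      - F \<sigma> / (x i - x j)
      - (\<Sum>m\<in>C. F (\<sigma> \<circ> (transpose i j \<circ> transpose j m)) / (x i - x m))"
  proof -
    have "\<sigma> (transpose i j m) = \<sigma> m" if "m \<in> C" for m
      using that by (auto simp: C_def transpose_def)
    then show ?thesis
      using op_j[OF permutes_comp_transpose[OF \<sigma>, of i j]] ij
      by (simp add: x_def comp_assoc)
  qed
  \<comment> \<open>After \<open>transpose i k\<close> position \<open>i\<close> carries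
    \<open>\<sigma> k\<close> and position \<open>k\<close> carries \<open>\<sigma> i\<close>. The
    terms of index \<open>i\<close> and \<open>k\<close> are therefore split off; they are the
    3-cycles.\<close>
  have at_ik: "cm_op N l a j F (\<sigma> \<circ> transpose i k) = a (\<sigma> j) * F (\<sigma> \<circ> transpose i k)
      - F (\<sigma> \<circ> (transpose i k \<circ> transpose i j)) / (x j - x k)
      - F (\<sigma> \<circ> (transpose i k \<circ> transpose j k)) / (x j - x i)
      - (\<Sum>m\<in>C - {k}. F (\<sigma> \<circ> (transpose i k \<circ> transpose j m)) / (x j - x m))" if k: "k \<in> C" for k
  proof -
    have "\<sigma> (transpose i k m) = \<sigma> m" if "m \<in> C - {k}" for m
      using that by (auto simp: C_def transpose_def)
    moreover have "\<sigma> (transpose i k j) = \<sigma> j"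
      using k ij by (auto simp: C_def transpose_def)
    moreover have "k < N" "k \<noteq> i" "k \<noteq> j" using k by (auto simp: C_def)
    ultimately show ?thesis
      using op_j[OF permutes_comp_transpose[OF \<sigma>, of i k]] ij
      by (simp add: x_def comp_assoc sum.remove[OF finC k])
  qed
  have cyc: "transpose i k \<circ> transpose i j = transpose i j \<circ> transpose j k"
    "transpose i k \<circ> transpose j k = transpose j i \<circ> transpose i k" if "k \<in> C" for k
    using that ij inj_comp_transpose[OF inj_transpose, of i j j k]
      inj_comp_transpose[OF inj_transpose, of i k j k]
    by (auto simp: C_def transpose_apply_other)
  have "cm_op N l a i (cm_op N l a j F) \<sigma> = a (\<sigma> i) * cm_op N l a j F \<sigma>
      - cm_op N l a j F (\<sigma> \<circ> transpose i j) / (x i - x j)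
      - (\<Sum>k\<in>C. cm_op N l a j F (\<sigma> \<circ> transpose i k) / (x i - x k))"
    using \<sigma> finC jC unfolding cm_op_def[of N l a i] Ci by (simp add: x_def algebra_simps)
  also have "\<dots> = a (\<sigma> i) * (a (\<sigma> j) * F \<sigma> - F (\<sigma> \<circ> transpose i j) / (x j - x i)
      - (\<Sum>m\<in>C. F (\<sigma> \<circ> transpose j m) / (x j - x m)))
      - (a (\<sigma> i) * F (\<sigma> \<circ> transpose i j) - F \<sigma> / (x i - x j)
      - (\<Sum>m\<in>C. F (\<sigma> \<circ> (transpose i j \<circ> transpose j m)) / (x i - x m))) / (x i - x j)
      - (\<Sum>k\<in>C. (a (\<sigma> j) * F (\<sigma> \<circ> transpose i k)
      - F (\<sigma> \<circ> (transpose i j \<circ> transpose j k)) / (x j - x k)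
      - F (\<sigma> \<circ> (transpose j i \<circ> transpose i k)) / (x j - x i)
      - (\<Sum>m\<in>C - {k}. F (\<sigma> \<circ> (transpose i k \<circ> transpose j m)) / (x j - x m))) / (x i - x k))"
    unfolding op_j[OF \<sigma>] at_ij by (simp add: at_ik cyc x_def cong: sum.cong)
  also have "\<dots> = a (\<sigma> i) * a (\<sigma> j) * F \<sigma>
      - (\<Sum>k\<in>C. a (\<sigma> i) * F (\<sigma> \<circ> transpose j k) / (x j - x k))
      - (\<Sum>k\<in>C. a (\<sigma> j) * F (\<sigma> \<circ> transpose i k) / (x i - x k))
      + F \<sigma> / (x i - x j)^2
      + ((\<Sum>k\<in>C. F (\<sigma> \<circ> (transpose i j \<circ> transpose j k)) / ((x i - x k) * (x i - x j)))
      + (\<Sum>k\<in>C. F (\<sigma> \<circ> (transpose i j \<circ> transpose j k)) / ((x j - x k) * (x i - x k)))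
      + (\<Sum>k\<in>C. F (\<sigma> \<circ> (transpose j i \<circ> transpose i k)) / ((x j - x i) * (x i - x k))))
      + (\<Sum>k\<in>C. \<Sum>m\<in>C - {k}. F (\<sigma> \<circ> (transpose i k \<circ> transpose j m)) / ((x i - x k) * (x j - x m)))"
  proof -
    \<comment> \<open>With this sign change the two terms in
      \<open>F (\<sigma> \<circ> transpose i j)\<close> cancel.\<close>
    have "F (\<sigma> \<circ> transpose i j) / (x j - x i) = - (F (\<sigma> \<circ> transpose i j) / (x i - x j))"
      by (metis minus_diff_eq minus_divide_right)
    then show ?thesis
      by (simp add: diff_divide_distrib sum_subtractf sum_distrib_left sum_divide_distrib
          right_diff_distrib distrib_left power2_eq_square mult.commute mult.assoc)
  qed
  also have "(\<Sum>k\<in>C. F (\<sigma> \<circ> (transpose i j \<circ> transpose j k)) / ((x i - x k) * (x i - x j)))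
      + (\<Sum>k\<in>C. F (\<sigma> \<circ> (transpose i j \<circ> transpose j k)) / ((x j - x k) * (x i - x k)))
      + (\<Sum>k\<in>C. F (\<sigma> \<circ> (transpose j i \<circ> transpose i k)) / ((x j - x i) * (x i - x k)))
      = (\<Sum>k\<in>C. F (\<sigma> \<circ> (transpose i j \<circ> transpose j k)) / ((x i - x j) * (x j - x k))
           + F (\<sigma> \<circ> (transpose j i \<circ> transpose i k)) / ((x j - x i) * (x i - x k)))"
    unfolding sum.distrib[symmetric]
  proof (intro sum.cong refl arg_cong2[of _ _ _ _ "(+)"])
    fix k assume "k \<in> C"
    then have "k < N" "i \<noteq> k" "j \<noteq> k" by (auto simp: C_def)
    then have "x i \<noteq> x k" "x j \<noteq> x k" "x i \<noteq> x j"
      using ij ne by blast+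
    then show "F (\<sigma> \<circ> (transpose i j \<circ> transpose j k)) / ((x i - x k) * (x i - x j))
        + F (\<sigma> \<circ> (transpose i j \<circ> transpose j k)) / ((x j - x k) * (x i - x k))
        = F (\<sigma> \<circ> (transpose i j \<circ> transpose j k)) / ((x i - x j) * (x j - x k))"
      by (simp add: divide_simps) (simp add: algebra_simps)
  qed
  finally show ?thesis .
qed

text \<open>Exchanging \<open>i\<close> and \<open>j\<close> permutes the terms of
  \<open>cm_op_cm_op\<close> visibly, except for the double sum. There the summation indices are
  swapped and disjoint transpositions commute.\<close>

lemma cm_op_commute:
  assumes inj: "inj_on l {..<N}" and ij: "i < N" "j < N"
  shows "cm_op N l a i (cm_op N l a j F) = cm_op N l a j (cm_op N l a i F)"
proof
  fix \<sigma>
  show "cm_op N l a i (cm_op N l a j F) \<sigma> = cm_op N l a j (cm_op N l a i F) \<sigma>"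
  proof (cases "\<sigma> permutes {..<N} \<and> i \<noteq> j")
    case True
    define C where "C = {..<N} - {i, j}"
    have C: "{..<N} - {j, i} = C" by (auto simp: C_def)
    have fin: "finite C" by (simp add: C_def)
    have tr: "transpose j m \<circ> transpose i k = transpose i k \<circ> transpose j m"
      if "k \<in> C" "m \<in> C - {k}" for k m
      using that True inj_comp_transpose[OF inj_transpose, of j m i k]
      by (auto simp: C_def transpose_apply_other)
    have "(\<Sum>m\<in>C. \<Sum>k\<in>C - {m}. F (\<sigma> \<circ> (transpose j m \<circ> transpose i k))
          / ((l (\<sigma> j) - l (\<sigma> m)) * (l (\<sigma> i) - l (\<sigma> k))))
      = (\<Sum>k\<in>C. \<Sum>m\<in>C - {k}. F (\<sigma> \<circ> (transpose j m \<circ> transpose i k))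
          / ((l (\<sigma> j) - l (\<sigma> m)) * (l (\<sigma> i) - l (\<sigma> k))))"
      unfolding sum.Sigma[OF fin ballI[OF finite_Diff[OF fin]]]
      by (rule sum.reindex_bij_witness[of _ prod.swap prod.swap]) auto
    also have "\<dots> = (\<Sum>k\<in>C. \<Sum>m\<in>C - {k}. F (\<sigma> \<circ> (transpose i k \<circ> transpose j m))
          / ((l (\<sigma> i) - l (\<sigma> k)) * (l (\<sigma> j) - l (\<sigma> m))))"
      by (intro sum.cong refl) (simp add: tr mult.commute)
    finally have sw: "(\<Sum>m\<in>C. \<Sum>k\<in>C - {m}. F (\<sigma> \<circ> (transpose j m \<circ> transpose i k))
          / ((l (\<sigma> j) - l (\<sigma> m)) * (l (\<sigma> i) - l (\<sigma> k)))) = \<dots>" .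
    show ?thesis
      using True ij cm_op_cm_op[OF inj, of \<sigma> i j a F] cm_op_cm_op[OF inj, of \<sigma> j i a F] sw
      by (simp add: C C_def[symmetric] power2_commute[of "l (\<sigma> j)"] sum.distrib mult.commute[of "a (\<sigma> j)"])
  qed (auto simp: cm_op_def)
qed

text \<open>The reversed list lets operator \<open>k\<close> act last, on the determinants for the
  first \<open>k\<close> positions. Transposing \<open>k\<close> with a later position leaves the
  index set alone, and these terms form the correction in \<open>cm_diag\<close>; transposing with
  an earlier \<open>j\<close> replaces \<open>\<sigma> j\<close> by \<open>\<sigma> k\<close>, which
  gives the sum in \<open>det_cm_mat_expand\<close>.\<close>

lemma cm_op_foldr_one:
  assumes inj: "inj_on l {..<N}" and "k \<le> N" and "\<sigma> permutes {..<N}"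
  shows "foldr (cm_op N l a) (rev [0..<k]) (\<lambda>\<sigma>. if \<sigma> permutes {..<N} then 1 else 0) \<sigma>
    = det (cm_mat N l a (\<sigma> ` {..<k}))"
  using assms(2,3)
proof (induction k arbitrary: \<sigma>)
  case 0
  have "cm_mat N l a {} = 1\<^sub>m N"
    by (intro eq_matI) (auto simp: cm_mat_def)
  then show ?case using 0 by simp
next
  case (Suc k)
  note \<sigma> = Suc.prems(2)
  let ?D = "\<lambda>S. det (cm_mat N l a S)"
  let ?B = "foldr (cm_op N l a) (rev [0..<k]) (\<lambda>\<sigma>. if \<sigma> permutes {..<N} then 1 else 0)"
  define U where "U = \<sigma> ` {..<Suc k}"
  have inj\<sigma>: "inj \<sigma>" using permutes_inj[OF \<sigma>] .
  have kN: "k < N" using Suc.prems by simp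
  have U: "U \<subseteq> {..<N}" and kU: "\<sigma> k \<in> U"
    using image_mono[of "{..<Suc k}" "{..<N}" \<sigma>] permutes_image[OF \<sigma>] Suc.prems(1)
    by (simp_all add: U_def)
  have Uk: "\<sigma> ` {..<k} = U - {\<sigma> k}"
    using inj\<sigma> by (auto simp: U_def lessThan_Suc inj_eq)
  have IH: "?B (\<sigma> \<circ> transpose k j) = ?D ((\<sigma> \<circ> transpose k j) ` {..<k})" if "j < N" for j
    using kN that by (intro Suc.IH permutes_comp_transpose \<sigma>) simp_all
  have B: "?B (\<sigma> \<circ> transpose k j) = ?D (U - {\<sigma> j})" if "j < k" for j
  proof -
    have "{..<k} = {..<Suc k} - {k}" by auto
    also have "transpose k j ` \<dots> = transpose k j ` {..<Suc k} - transpose k j ` {k}"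
      by (rule image_set_diff[OF inj_transpose])
    also have "transpose k j ` {..<Suc k} = {..<Suc k}"
      using that by simp
    finally have "transpose k j ` {..<k} = {..<Suc k} - {j}" by simp
    then have "(\<sigma> \<circ> transpose k j) ` {..<k} = U - {\<sigma> j}"
      using inj\<sigma> by (simp only: image_comp[symmetric] U_def image_set_diff image_insert image_empty)
    then show ?thesis
      using IH[of j] that kN by (simp only: less_trans)
  qed
  have B': "?B (\<sigma> \<circ> transpose k j) = ?D (U - {\<sigma> k})" if "j \<in> {k<..<N}" for j
  proof -
    have "(\<sigma> \<circ> transpose k j) ` {..<k} = \<sigma> ` {..<k}"
      using that by (intro image_cong) (auto simp: transpose_def)
    then show ?thesis
      using IH[of j] that by (simp only: Uk greaterThanLessThan_iff)
  qed
  have "{..<N} - {k} = {..<k} \<union> {k<..<N}" using kN by auto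
  then have "foldr (cm_op N l a) (rev [0..<Suc k]) (\<lambda>\<sigma>. if \<sigma> permutes {..<N} then 1 else 0) \<sigma>
      = a (\<sigma> k) * ?B \<sigma> - (\<Sum>j\<in>{..<k} \<union> {k<..<N}. ?B (\<sigma> \<circ> transpose k j) / (l (\<sigma> k) - l (\<sigma> j)))"
    using \<sigma> by (simp add: cm_op_def)
  also have "\<dots> = a (\<sigma> k) * ?D (U - {\<sigma> k})
      - (\<Sum>j<k. ?D (U - {\<sigma> j}) / (l (\<sigma> k) - l (\<sigma> j)))
      - (\<Sum>j\<in>{k<..<N}. ?D (U - {\<sigma> k}) / (l (\<sigma> k) - l (\<sigma> j)))"
    using Suc.IH[OF _ \<sigma>] kN by (subst sum.union_disjoint) (auto simp: B B' Uk)
  also have "(\<Sum>j<k. ?D (U - {\<sigma> j}) / (l (\<sigma> k) - l (\<sigma> j)))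
      = (\<Sum>n\<in>U - {\<sigma> k}. ?D (U - {n}) / (l (\<sigma> k) - l n))"
    unfolding Uk[symmetric] using inj\<sigma> by (subst sum.reindex) (auto intro: inj_on_subset)
  also have "(\<Sum>j\<in>{k<..<N}. ?D (U - {\<sigma> k}) / (l (\<sigma> k) - l (\<sigma> j)))
      = ?D (U - {\<sigma> k}) * (\<Sum>n\<in>{..<N} - U. 1 / (l (\<sigma> k) - l n))"
  proof -
    have "{..<N} - U = \<sigma> ` ({..<N} - {..<Suc k})"
      using permutes_image[OF \<sigma>] inj\<sigma> by (simp only: U_def image_set_diff)
    also have "{..<N} - {..<Suc k} = {k<..<N}" by auto
    finally show ?thesis
      using inj\<sigma> by (simp add: sum.reindex inj_on_subset sum_distrib_left)
  qed
  finally show ?case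
    unfolding det_cm_mat_expand[OF inj U kU] U_def[symmetric]
    by (simp add: cm_diag_def algebra_simps)
qed

section \<open>The spectral parameter and the characteristic polynomial\<close>

text \<open>A shift is absorbed into the parameters \<open>a\<close>, so the evaluation of operator
  products at 1 applies for every \<open>x\<close>. Off the permutations the shift leaves
  \<open>- x * F \<sigma>\<close>, hence the hypothesis on \<open>F\<close>.\<close>

lemma shift_op_cm_op:
  assumes "\<And>\<sigma>. \<not> \<sigma> permutes {..<N} \<Longrightarrow> F \<sigma> = 0"
  shows "shift_op (cm_op N l a) x i F = cm_op N l (\<lambda>i. a i - x) i F"
  using assms by (auto simp: shift_op_def cm_op_def fun_eq_iff algebra_simps)

lemma foldr_shift_op_cm_op:
  assumes "\<And>\<sigma>. \<not> \<sigma> permutes {..<N} \<Longrightarrow> F \<sigma> = 0"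
  shows "foldr (shift_op (cm_op N l a) x) js F = foldr (cm_op N l (\<lambda>i. a i - x)) js F"
proof (induction js)
  case (Cons j js)
  have "foldr (cm_op N l (\<lambda>i. a i - x)) js F \<sigma> = 0" if "\<not> \<sigma> permutes {..<N}" for \<sigma>
    using that assms by (cases js) (auto simp: cm_op_def)
  then show ?case using Cons by (simp add: shift_op_cm_op)
qed simp

text \<open>\<open>char_matrix A x\<close> is \<open>A - x\<close>, while the characteristic
  polynomial is \<open>det (x - A)\<close>; the sign \<open>(-1) ^ n\<close> is spread over the
  \<open>n\<close> linear factors. Roots are listed with multiplicity, to match one root with each
  operator.\<close>

lemma det_char_matrix_eq_prod:
  fixes A :: "complex mat"
  assumes A: "A \<in> carrier_mat n n"
  obtains zs where "length zs = n" "\<And>z. z \<in> set zs \<Longrightarrow> eigenvalue A z"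
    "\<And>x. det (char_matrix A x) = (\<Prod>z\<leftarrow>zs. z - x)"
proof -
  obtain zs where zs: "char_poly A = (\<Prod>z\<leftarrow>zs. [:- z, 1:])" "length zs = n"
    using char_poly_factorized[OF A] by blast
  have poly: "poly (char_poly A) x = (\<Prod>z\<leftarrow>zs. x - z)" for x
    by (simp add: zs(1) poly_prod_list o_def)
  have eig: "eigenvalue A z" if "z \<in> set zs" for z
    using that unfolding eigenvalue_root_char_poly[OF A] poly by (auto simp: prod_list_zero_iff)
  have "(-1) ^ length ys * (\<Prod>z\<leftarrow>ys. x - z) = (\<Prod>z\<leftarrow>ys. z - x)" for ys and x :: complex
    by (induction ys) (simp_all add: algebra_simps)
  moreover have "det (char_matrix A x) = (-1) ^ n * poly (char_poly A) x" for x
  proof -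
    have c: "char_matrix A x \<in> carrier_mat n n" using A by simp
    have "- char_matrix A x = (-1) \<cdot>\<^sub>m char_matrix A x" by (intro eq_matI) auto
    then have "poly (char_poly A) x = (-1) ^ n * det (char_matrix A x)"
      using c by (simp add: char_poly_matrix[OF A])
    then show ?thesis by (simp add: power_mult_distrib[symmetric] flip: mult.assoc)
  qed
  ultimately show ?thesis
    using that zs(2) eig poly by metis
qed

section \<open>Reality of the diagonal entries\<close>

text \<open>A Rayleigh quotient: the reread equation is multiplied by
  \<open>cnj (u \<sigma>)\<close> and summed over all permutations. This gives \<open>a m\<close>
  times the positive number \<open>Q\<close> on one side and a real number on the other.\<close>

lemma cm_op_joint_eigenvalues_real:
  fixes l :: "nat \<Rightarrow> real"
  assumes eig: "\<And>i. i < N \<Longrightarrow> w i \<in> \<real> \<and> cm_op N (\<lambda>i. of_real (l i)) a i u = (\<lambda>\<sigma>. w i * u \<sigma>)"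
    and \<sigma>0: "\<sigma>\<^sub>0 permutes {..<N}" "u \<sigma>\<^sub>0 \<noteq> 0" and m: "m < N"
  shows "a m \<in> \<real>"
proof -
  define P where "P = {\<sigma>. \<sigma> permutes {..<N}}"
  have finP: "finite P" by (simp add: P_def finite_permutations)
  \<comment> \<open>The equation is taken at the position \<open>i\<close> that carries label
    \<open>m\<close>, and the sum over positions \<open>j\<close> is reindexed by labels
    \<open>n = \<sigma> j\<close>.\<close>
  have eq: "a m * u \<sigma> = w (inv_into UNIV \<sigma> m) * u \<sigma>
      + (\<Sum>n\<in>{..<N} - {m}. u (transpose m n \<circ> \<sigma>) / of_real (l m - l n))" if "\<sigma> \<in> P" for \<sigma>
  proof -
    have \<sigma>: "\<sigma> permutes {..<N}" using that by (simp add: P_def)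
    define i where "i = inv_into UNIV \<sigma> m"
    have \<sigma>i: "\<sigma> i = m" by (simp add: i_def permutes_inverses[OF \<sigma>])
    have iN: "i < N" using permutes_in_image[OF \<sigma>, of i] \<sigma>i m by simp
    have img: "{..<N} - {m} = \<sigma> ` ({..<N} - {i})"
      using permutes_image[OF \<sigma>] permutes_inj[OF \<sigma>] \<sigma>i by (simp add: image_set_diff)
    have "(\<Sum>n\<in>{..<N} - {m}. u (transpose m n \<circ> \<sigma>) / of_real (l m - l n))
        = (\<Sum>j\<in>{..<N} - {i}. u (\<sigma> \<circ> transpose i j) / (of_real (l (\<sigma> i)) - of_real (l (\<sigma> j))))"
      unfolding img using permutes_inj_on[OF \<sigma>]
      by (simp add: sum.reindex inj_comp_transpose[OF permutes_inj[OF \<sigma>]] \<sigma>i)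
    moreover have "cm_op N (\<lambda>i. of_real (l i)) a i u \<sigma> = w i * u \<sigma>"
      using eig[OF iN] by simp
    ultimately show ?thesis
      using \<sigma> by (simp add: cm_op_def \<sigma>i i_def[symmetric] diff_eq_eq)
  qed
  \<comment> \<open>Left multiplication by \<open>transpose m n\<close> is an involution of
    \<open>P\<close>; reindexing by it turns the sum into its own conjugate.\<close>
  have real_sum: "(\<Sum>\<sigma>\<in>P. cnj (u \<sigma>) * u (transpose m n \<circ> \<sigma>)) \<in> \<real>" if "n < N" for n
  proof -
    have "transpose m n \<circ> \<sigma> \<in> P" if "\<sigma> \<in> P" for \<sigma>
      using that m \<open>n < N\<close> by (simp add: P_def permutes_compose permutes_swap_id)
    moreover have "transpose m n \<circ> (transpose m n \<circ> \<sigma>) = \<sigma>" for \<sigma> :: "nat \<Rightarrow> nat"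
      by (simp add: fun_eq_iff)
    ultimately have "(\<Sum>\<sigma>\<in>P. cnj (u \<sigma>) * u (transpose m n \<circ> \<sigma>))
        = (\<Sum>\<sigma>\<in>P. cnj (u (transpose m n \<circ> \<sigma>)) * u \<sigma>)"
      by (intro sum.reindex_bij_witness[of _ "\<lambda>\<sigma>. transpose m n \<circ> \<sigma>" "\<lambda>\<sigma>. transpose m n \<circ> \<sigma>"]) simp_all
    then show ?thesis
      by (simp add: Reals_cnj_iff mult.commute)
  qed
  define Q where "Q = (\<Sum>\<sigma>\<in>P. cnj (u \<sigma>) * u \<sigma>)"
  have Q: "Q = of_real (\<Sum>\<sigma>\<in>P. (cmod (u \<sigma>))\<^sup>2)"
    unfolding Q_def of_real_sum
    by (intro sum.cong refl) (metis complex_norm_square mult.commute)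
  have "(\<Sum>\<sigma>\<in>P. (cmod (u \<sigma>))\<^sup>2) \<noteq> 0"
    using \<sigma>0 finP by (auto simp: sum_nonneg_eq_0_iff P_def)
  then have Q0: "Q \<noteq> 0" using Q by (simp only: of_real_eq_0_iff) simp
  have "a m * Q = (\<Sum>\<sigma>\<in>P. cnj (u \<sigma>) * (a m * u \<sigma>))"
    by (simp add: Q_def sum_distrib_left algebra_simps)
  also have "\<dots> = (\<Sum>\<sigma>\<in>P. w (inv_into UNIV \<sigma> m) * (cnj (u \<sigma>) * u \<sigma>))
      + (\<Sum>\<sigma>\<in>P. \<Sum>n\<in>{..<N} - {m}. cnj (u \<sigma>) * u (transpose m n \<circ> \<sigma>) / of_real (l m - l n))"
    by (simp add: eq distrib_left sum.distrib sum_distrib_left mult.left_commute cong: sum.cong)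
  also have "(\<Sum>\<sigma>\<in>P. \<Sum>n\<in>{..<N} - {m}. cnj (u \<sigma>) * u (transpose m n \<circ> \<sigma>) / of_real (l m - l n))
      = (\<Sum>n\<in>{..<N} - {m}. (\<Sum>\<sigma>\<in>P. cnj (u \<sigma>) * u (transpose m n \<circ> \<sigma>)) / of_real (l m - l n))"
    by (subst sum.swap) (simp add: sum_divide_distrib)
  also have "(\<Sum>\<sigma>\<in>P. w (inv_into UNIV \<sigma> m) * (cnj (u \<sigma>) * u \<sigma>)) + \<dots> \<in> \<real>"
  proof (intro Reals_add sum_in_Reals)
    fix \<sigma> assume "\<sigma> \<in> P"
    then have "inv_into UNIV \<sigma> m < N"
      using permutes_in_image[OF permutes_inv, of \<sigma> "{..<N}" m] m by (simp add: P_def)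
    then have "w (inv_into UNIV \<sigma> m) \<in> \<real>" using eig by blast
    moreover have "cnj (u \<sigma>) * u \<sigma> \<in> \<real>"
      by (simp add: Reals_cnj_iff mult.commute)
    ultimately show "w (inv_into UNIV \<sigma> m) * (cnj (u \<sigma>) * u \<sigma>) \<in> \<real>"
      by (rule Reals_mult)
  next
    fix n assume "n \<in> {..<N} - {m}"
    then show "(\<Sum>\<sigma>\<in>P. cnj (u \<sigma>) * u (transpose m n \<circ> \<sigma>)) / of_real (l m - l n) \<in> \<real>"
      by (intro Reals_divide real_sum Reals_of_real) simp
  qed
  finally have "a m * Q \<in> \<real>" .
  then have "a m * Q / Q \<in> \<real>" using Q by (intro Reals_divide) auto
  then show ?thesis using Q0 by simp
qed

theorem theorem6p4:
  fixes N :: nat and l :: "nat \<Rightarrow> real" and a :: "nat \<Rightarrow> complex"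
  assumes "N \<ge> 2"
    and "inj_on l {..<N}"
    and "\<And>z. eigenvalue (Z_mat N l a) z \<Longrightarrow> z \<in> \<real>"
  shows "\<forall>i<N. a i \<in> \<real>"
proof (intro allI impI)
  fix m assume m: "m < N"
  define L where "L i = complex_of_real (l i)" for i
  define A where "A = cm_op N L a"
  define one :: "(nat \<Rightarrow> nat) \<Rightarrow> complex" where "one = (\<lambda>\<sigma>. if \<sigma> permutes {..<N} then 1 else 0)"
  \<comment> \<open>Kept as invariant so that a nonzero joint eigenvector is nonzero at an actual
    permutation.\<close>
  let ?P = "\<lambda>u::(nat \<Rightarrow> nat) \<Rightarrow> complex. \<forall>\<sigma>. \<not> \<sigma> permutes {..<N} \<longrightarrow> u \<sigma> = 0"
  have inj: "inj_on L {..<N}" using assms(2) by (auto simp: L_def inj_on_def)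
  have Z: "Z_mat N l a \<in> carrier_mat N N" by (simp add: Z_mat_def)
  obtain zs where zs: "length zs = N" "\<And>z. z \<in> set zs \<Longrightarrow> eigenvalue (Z_mat N l a) z"
    "\<And>x. det (char_matrix (Z_mat N l a) x) = (\<Prod>z\<leftarrow>zs. z - x)"
    using det_char_matrix_eq_prod[OF Z] by blast
  have "\<exists>u. ?P u \<and> u \<noteq> (\<lambda>_. 0) \<and> (\<forall>j\<in>set (rev [0..<N]). \<exists>w\<in>set zs. A j u = (\<lambda>\<sigma>. w * u \<sigma>))"
  proof (rule joint_eigenvector[where J = "{..<N}" and v = one])
    show "A i (A j u) = A j (A i u)" if "i \<in> {..<N}" "j \<in> {..<N}" for i j u
      unfolding A_def using cm_op_commute[OF inj] that by blast
    show "A j (\<lambda>p. c * u p + d * v p) = (\<lambda>p. c * A j u p + d * A j v p)" for j c d u v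
      by (simp add: A_def cm_op_def fun_eq_iff sum_distrib_left sum.distrib add_divide_distrib
          algebra_simps)
    show "continuous_on UNIV (\<lambda>x::complex. A j (f x) p)"
      if "\<And>p. continuous_on UNIV (\<lambda>x. f x p)" for j f p
      by (cases "p permutes {..<N}")
        (auto simp: A_def cm_op_def divide_inverse intro!: continuous_intros that)
    show "?P (shift_op A x j u)" if "?P u" for j x u
      using that by (simp add: shift_op_def A_def cm_op_def)
    have "one id \<noteq> 0" by (simp add: one_def permutes_id)
    then show "one \<noteq> (\<lambda>_. 0)" by metis
    show "foldr (shift_op A x) (rev [0..<N]) one = (\<lambda>\<sigma>. (\<Prod>z\<leftarrow>zs. z - x) * one \<sigma>)" for x
    proof
      fix \<sigma>
      have sh: "foldr (shift_op A x) (rev [0..<N]) one = foldr (cm_op N L (\<lambda>i. a i - x)) (rev [0..<N]) one"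
        unfolding A_def by (rule foldr_shift_op_cm_op) (simp add: one_def)
      \<comment> \<open>For the full index set the diagonal correction is an empty sum and no
        padding remains.\<close>
      have full: "cm_mat N L (\<lambda>i. a i - x) {..<N} = char_matrix (Z_mat N l a) x"
        by (intro eq_matI) (auto simp: cm_mat_def char_matrix_def Z_mat_def cm_diag_def L_def)
      show "foldr (shift_op A x) (rev [0..<N]) one \<sigma> = (\<Prod>z\<leftarrow>zs. z - x) * one \<sigma>"
      proof (cases "\<sigma> permutes {..<N}")
        case True
        then show ?thesis
          unfolding sh using cm_op_foldr_one[OF inj le_refl True] permutes_image[OF True] zs(3) full
          by (simp add: one_def)
      next
        case False
        \<comment> \<open>As \<open>N\<close> is positive, the outermost factor is a
          \<open>cm_op\<close>, which vanishes at \<open>\<sigma>\<close>, as does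
          \<open>one\<close>.\<close>
        then show ?thesis
          unfolding sh using assms(1) by (cases N) (auto simp: one_def cm_op_def)
      qed
    qed
  qed (use zs in \<open>auto simp: one_def\<close>)
  then obtain u where u: "?P u" "u \<noteq> (\<lambda>_. 0)"
    and "\<forall>j<N. \<exists>w\<in>set zs. A j u = (\<lambda>\<sigma>. w * u \<sigma>)"
    by auto
  then obtain w where w: "\<And>j. j < N \<Longrightarrow> w j \<in> set zs \<and> A j u = (\<lambda>\<sigma>. w j * u \<sigma>)"
    by metis
  obtain \<sigma>\<^sub>0 where "\<sigma>\<^sub>0 permutes {..<N}" "u \<sigma>\<^sub>0 \<noteq> 0" using u by fastforce
  then show "a m \<in> \<real>"
    using w zs(2) assms(3) m
    by (intro cm_op_joint_eigenvalues_real[of N w l a u]) (auto simp: A_def L_def[abs_def])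
qed

end
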